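(* Let $X$ be a Tychonoff space which has the inductive topology with respect to a countable cover $\{X_n\}_{n\in\omega}$ of $X$ by subspaces $X_n$. (i) If for every $n\in\omega$ the free topological vector space $\mathsf V(X_n)$ has a local $\mathfrak G$-base, then the free topological vector space $\mathsf V(X)$ has a local $\mathfrak G$-base. (ii) If for every $n\in\omega$ the free locally convex space $\mathsf L(X_n)$ has a local $\mathfrak G$-base, then the free locally convex space $\mathsf L(X)$ has a local $\mathfrak G$-base.
   Context: $X$ carries the inductive topology with respect to a family $(X_n)_{n\in\omega}$ of its subsets if a set $V\subset X$ is open in $X$ iff $V\cap X_n$ is open in $X_n$ (subspace topology) for every $n\in\omega$. $\omega^\omega$ is the set of all functions $\omega\to\omega$ with the coordinatewise partial order. A topological space has a local $\mathfrak G$-base if every point has a neighborhood base $(U_\alpha)_{\alpha\in\omega^\omega}$ with $U_\beta\subset U_\alpha$ whenever $\alpha\le\beta$. All topological vector spaces are real and Hausdorff. The free locally convex space of a topological space $X$ is a pair $(\mathsf L(X),\delta_X)$ of a locally convex space and a continuous map $\delta_X:X\to\mathsf L(X)$ such that for every continuous map $f:X\to Y$ into a locally convex space $Y$ there is a unique continuous linear operator $\bar f:\mathsf L(X)\to Y$ with $\bar f\circ\delta_X=f$. The free topological vector space $(\mathsf V(X),\delta_X)$ is defined in the same way with "locally convex space" replaced by "topological vector space". *)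

theory Defs
  imports "HOL-Analysis.Analysis" "HOL-Library.Poly_Mapping"
begin

section \<open>Topological vector spaces\<close>

text \<open>A topological vector space is given by a topology whose underlying set is a linear subspace
  of an ambient real vector space; the ambient type itself carries no topology. This allows
  spaces of different dimensions to live in one type.\<close>

definition tvs :: "'v::real_vector topology \<Rightarrow> bool" where
  "tvs T \<longleftrightarrow> subspace (topspace T) \<and> Hausdorff_space T \<and>
     continuous_map (prod_topology T T) T (\<lambda>(x, y). x + y) \<and>
     continuous_map (prod_topology euclideanreal T) T (\<lambda>(r, x). r *\<^sub>R x)"

definition lcs :: "'v::real_vector topology \<Rightarrow> bool" where
  "lcs T \<longleftrightarrow> tvs T \<and> neighbourhood_base_at 0 convex T"

definition continuous_linear_map ::
    "'v::real_vector topology \<Rightarrow> 'w::real_vector topology \<Rightarrow> ('v \<Rightarrow> 'w) \<Rightarrow> bool" where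
  "continuous_linear_map V W g \<longleftrightarrow> continuous_map V W g \<and>
     (\<forall>x\<in>topspace V. \<forall>y\<in>topspace V. g (x + y) = g x + g y) \<and>
     (\<forall>r. \<forall>x\<in>topspace V. g (r *\<^sub>R x) = r *\<^sub>R g x)"

section \<open>Local \<open>\<GG>\<close>-bases and inductive topologies\<close>

text \<open>The order on \<open>nat \<Rightarrow> nat\<close> is the library's pointwise order. Neighborhoods need not be open.\<close>

definition local_G_base :: "'a topology \<Rightarrow> bool" where
  "local_G_base T \<longleftrightarrow> (\<forall>x\<in>topspace T. \<exists>U :: (nat \<Rightarrow> nat) \<Rightarrow> 'a set.
     (\<forall>\<alpha>. U \<alpha> \<subseteq> topspace T \<and> (\<exists>W. openin T W \<and> x \<in> W \<and> W \<subseteq> U \<alpha>)) \<and>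
     (\<forall>W. openin T W \<and> x \<in> W \<longrightarrow> (\<exists>\<alpha>. U \<alpha> \<subseteq> W)) \<and>
     (\<forall>\<alpha> \<beta>. \<alpha> \<le> \<beta> \<longrightarrow> U \<beta> \<subseteq> U \<alpha>))"

definition has_inductive_topology :: "'a topology \<Rightarrow> (nat \<Rightarrow> 'a set) \<Rightarrow> bool" where
  "has_inductive_topology X A \<longleftrightarrow> (\<forall>n. A n \<subseteq> topspace X) \<and>
     (\<forall>V. V \<subseteq> topspace X \<longrightarrow>
        (openin X V \<longleftrightarrow> (\<forall>n. openin (subtopology X (A n)) (V \<inter> A n))))"

section \<open>Free topological vector spaces\<close>

text \<open>\<open>universal_among C X V d\<close> is the universal property of \<open>d\<close> with respect to the targets in the
  class \<open>C\<close>. Extensionality makes unique existence speak about functions on the carrier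
  of \<open>V\<close>.\<close>

definition universal_among :: "('y::real_vector topology \<Rightarrow> bool) \<Rightarrow>
    'a topology \<Rightarrow> 'v::real_vector topology \<Rightarrow> ('a \<Rightarrow> 'v) \<Rightarrow> bool" where
  "universal_among C X V d \<longleftrightarrow> (\<forall>Y f. C Y \<and> continuous_map X Y f \<longrightarrow>
     (\<exists>!g. g \<in> extensional (topspace V) \<and> continuous_linear_map V Y g \<and>
        (\<forall>x\<in>topspace X. g (d x) = f x)))"

instantiation poly_mapping :: (type, real_vector) real_vector
begin

definition scaleR_poly_mapping :: "real \<Rightarrow> ('a \<Rightarrow>\<^sub>0 'b) \<Rightarrow> 'a \<Rightarrow>\<^sub>0 'b" where
  "scaleR_poly_mapping r p = Poly_Mapping.map ((*\<^sub>R) r) p"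

lemma lookup_scaleR: "Poly_Mapping.lookup (r *\<^sub>R p) k = r *\<^sub>R Poly_Mapping.lookup p k"
  by (simp add: scaleR_poly_mapping_def Poly_Mapping.map.rep_eq when_def)

instance
  by standard
    (auto intro!: poly_mapping_eqI simp: lookup_scaleR Poly_Mapping.lookup_add algebra_simps)

end

text \<open>A definition cannot quantify over all types, so the targets range over all (locally convex)
  topological vector spaces inside one type. It has room for a copy of \<open>V\<close>
  itself and of the linear span of any image of \<open>X\<close>, which is enough to obtain the universal
  property for targets of every type: see \<open>free_tvs_universal\<close> and
  \<open>free_lcs_universal\<close> below.\<close>

definition free_tvs :: "'a topology \<Rightarrow> 'v::real_vector topology \<Rightarrow> ('a \<Rightarrow> 'v) \<Rightarrow> bool" where
  "free_tvs X V d \<longleftrightarrow> tvs V \<and> continuous_map X V d \<and>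
     universal_among (tvs :: (('a \<Rightarrow>\<^sub>0 real) \<times> 'v) topology \<Rightarrow> bool) X V d"

definition free_lcs :: "'a topology \<Rightarrow> 'v::real_vector topology \<Rightarrow> ('a \<Rightarrow> 'v) \<Rightarrow> bool" where
  "free_lcs X V d \<longleftrightarrow> lcs V \<and> continuous_map X V d \<and>
     universal_among (lcs :: (('a \<Rightarrow>\<^sub>0 real) \<times> 'v) topology \<Rightarrow> bool) X V d"

section \<open>The universal property for targets of arbitrary type\<close>

lemma tvs_pullback:
  fixes p :: "'u::real_vector \<Rightarrow> 'y::real_vector"
  assumes Y: "tvs Y" and p: "linear p" and S: "subspace S" and inj: "inj_on p S"
  shows "tvs (pullback_topology S p Y)"
proof -
  let ?T = "pullback_topology S p Y"
  have ts: "topspace ?T = p -` topspace Y \<inter> S" by (rule topspace_pullback_topology)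
  have pc: "continuous_map ?T Y p"
    using continuous_map_pullback[OF continuous_map_id, of S p Y] by simp
  have sub: "subspace (topspace ?T)"
    unfolding ts using Y S linear_subspace_vimage[OF p, of "topspace Y"]
    by (auto simp: tvs_def intro: subspace_inter)
  have haus: "Hausdorff_space ?T"
    unfolding Hausdorff_space_def
  proof (intro allI impI, elim conjE)
    fix x y assume xy: "x \<in> topspace ?T" "y \<in> topspace ?T" "x \<noteq> y"
    then have "p x \<in> topspace Y" "p y \<in> topspace Y" "p x \<noteq> p y"
      using inj by (auto simp: ts inj_on_def)
    then obtain U V where "openin Y U" "openin Y V" "p x \<in> U" "p y \<in> V" "disjnt U V"
      using Y unfolding tvs_def Hausdorff_space_def by metis
    then show "\<exists>U V. openin ?T U \<and> openin ?T V \<and> x \<in> U \<and> y \<in> V \<and> disjnt U V"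
      using xy by (intro exI[of _ "p -` U \<inter> S"] exI[of _ "p -` V \<inter> S"])
        (auto simp: openin_pullback_topology ts disjnt_def)
  qed
  have add: "continuous_map (prod_topology ?T ?T) ?T (\<lambda>(x, y). x + y)"
  proof (rule continuous_map_pullback')
    have "continuous_map (prod_topology ?T ?T) (prod_topology Y Y) (\<lambda>(x, y). (p x, p y))"
      by (simp add: continuous_map_prod_top pc)
    then have "continuous_map (prod_topology ?T ?T) Y ((\<lambda>(x, y). x + y) \<circ> (\<lambda>(x, y). (p x, p y)))"
      using Y continuous_map_compose unfolding tvs_def by blast
    then show "continuous_map (prod_topology ?T ?T) Y (p \<circ> (\<lambda>(x, y). x + y))"
      by (simp add: o_def case_prod_beta linear_add[OF p])
    show "topspace (prod_topology ?T ?T) \<subseteq> (\<lambda>(x, y). x + y) -` S"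
      using S by (auto simp: ts subspace_add)
  qed
  have scale: "continuous_map (prod_topology euclideanreal ?T) ?T (\<lambda>(r, x). r *\<^sub>R x)"
  proof (rule continuous_map_pullback')
    have "continuous_map (prod_topology euclideanreal ?T) (prod_topology euclideanreal Y)
        (\<lambda>(r, x). (id r, p x))"
      by (subst continuous_map_prod_top) (simp add: pc)
    then have "continuous_map (prod_topology euclideanreal ?T) Y
        ((\<lambda>(r, x). r *\<^sub>R x) \<circ> (\<lambda>(r, x). (id r, p x)))"
      using Y continuous_map_compose unfolding tvs_def by blast
    then show "continuous_map (prod_topology euclideanreal ?T) Y (p \<circ> (\<lambda>(r, x). r *\<^sub>R x))"
      by (simp add: o_def case_prod_beta linear_scale[OF p])
    show "topspace (prod_topology euclideanreal ?T) \<subseteq> (\<lambda>(r, x). r *\<^sub>R x) -` S"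
      using S by (auto simp: ts subspace_scale)
  qed
  show ?thesis using sub haus add scale by (simp add: tvs_def)
qed

lemma lcs_pullback:
  fixes p :: "'u::real_vector \<Rightarrow> 'y::real_vector"
  assumes Y: "lcs Y" and p: "linear p" and S: "subspace S" and inj: "inj_on p S"
  shows "lcs (pullback_topology S p Y)"
  unfolding lcs_def
proof
  show "tvs (pullback_topology S p Y)" using assms tvs_pullback by (auto simp: lcs_def)
  show "neighbourhood_base_at 0 convex (pullback_topology S p Y)"
    unfolding neighbourhood_base_at_def
  proof (intro allI impI, elim conjE)
    fix W assume "openin (pullback_topology S p Y) W" "0 \<in> W"
    then obtain W' where W': "openin Y W'" "W = p -` W' \<inter> S"
      by (auto simp: openin_pullback_topology)
    moreover have "0 \<in> W'" using \<open>0 \<in> W\<close> W' linear_0[OF p] by auto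
    ultimately obtain U V where "openin Y U" "convex V" "0 \<in> U" "U \<subseteq> V" "V \<subseteq> W'"
      using Y unfolding lcs_def neighbourhood_base_at_def by meson
    then show "\<exists>U V. openin (pullback_topology S p Y) U \<and> convex V \<and> 0 \<in> U \<and> U \<subseteq> V \<and> V \<subseteq> W"
      using W' linear_0[OF p] subspace_0[OF S]
        convex_Int[OF convex_linear_vimage[OF p] subspace_imp_convex[OF S], of V]
      by (intro exI[of _ "p -` U \<inter> S"] exI[of _ "p -` V \<inter> S"])
        (auto simp: openin_pullback_topology)
  qed
qed

text \<open>Every continuous image of \<open>X\<close> spans a space that embeds into the type of finitely supported
  functions on the points of \<open>X\<close>.\<close>

lemma embed_span:
  fixes f :: "'a \<Rightarrow> 'y::real_vector" and A :: "'a set"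
  obtains q :: "('a \<Rightarrow>\<^sub>0 real) \<times> 'v::real_vector \<Rightarrow> 'y" and e S
  where "linear q" "linear e" "subspace S" "inj_on q S" "q ` S = span (f ` A)"
    "\<And>y. y \<in> span (f ` A) \<Longrightarrow> e y \<in> S \<and> q (e y) = y"
proof -
  define h :: "('a \<Rightarrow>\<^sub>0 real) \<Rightarrow> 'y" where
    "h p = Sum_any (\<lambda>a. Poly_Mapping.lookup p a *\<^sub>R f a)" for p
  have fin: "finite {a. Poly_Mapping.lookup p a *\<^sub>R f a \<noteq> 0}" for p :: "'a \<Rightarrow>\<^sub>0 real"
    by (rule finite_subset[OF _ Poly_Mapping.finite_lookup[of p]]) auto
  have lh: "linear h"
  proof (rule linearI)
    fix p p' :: "'a \<Rightarrow>\<^sub>0 real" and r :: real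
    show "h (p + p') = h p + h p'"
      unfolding h_def Poly_Mapping.lookup_add scaleR_add_left
      by (rule Sum_any.distrib) (rule fin)+
    have "h (r *\<^sub>R p) = Sum_any (\<lambda>a. r *\<^sub>R (Poly_Mapping.lookup p a *\<^sub>R f a))"
      by (simp add: h_def lookup_scaleR)
    also have "\<dots> = r *\<^sub>R h p"
    proof (cases "r = 0")
      case False
      then have "{a. r *\<^sub>R (Poly_Mapping.lookup p a *\<^sub>R f a) \<noteq> 0} =
          {a. Poly_Mapping.lookup p a *\<^sub>R f a \<noteq> 0}" by auto
      then show ?thesis by (simp only: h_def Sum_any.expand_set scaleR_sum_right)
    qed simp
    finally show "h (r *\<^sub>R p) = r *\<^sub>R h p" .
  qed
  have hs: "h (Poly_Mapping.single a 1) = f a" for a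
  proof -
    have "(\<lambda>b. Poly_Mapping.lookup (Poly_Mapping.single a (1::real)) b *\<^sub>R f b) =
        (\<lambda>b. f b when b = a)"
      by (auto simp: Poly_Mapping.lookup_single when_def)
    then show ?thesis by (simp only: h_def Sum_any_when_equal)
  qed
  define B :: "('a \<Rightarrow>\<^sub>0 real) set" where "B = span ((\<lambda>a. Poly_Mapping.single a 1) ` A)"
  have hB: "h ` B = span (f ` A)"
    unfolding B_def linear_span_image[OF lh, symmetric] image_image hs ..
  obtain k where k: "linear k" "\<forall>v\<in>h ` B. h (k v) = v"
    using linear_exists_right_inverse_on[OF lh, of B] unfolding B_def by (auto)
  define q :: "('a \<Rightarrow>\<^sub>0 real) \<times> 'v \<Rightarrow> 'y" where "q = h \<circ> fst"
  define e :: "'y \<Rightarrow> ('a \<Rightarrow>\<^sub>0 real) \<times> 'v" where "e y = (k y, 0)" for y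
  have q: "linear q" unfolding q_def by (intro linear_compose linear_fst lh)
  have e: "linear e" unfolding e_def using k(1) by (auto intro!: linearI simp: linear_add linear_scale)
  have qe: "q (e y) = y" if "y \<in> span (f ` A)" for y
    using that k(2) by (simp add: q_def e_def hB)
  show thesis
  proof
    show "subspace (e ` span (f ` A))" using e by (simp add: linear_subspace_image)
    show "inj_on q (e ` span (f ` A))" by (rule inj_on_inverseI[of _ e]) (auto simp: qe)
    show "q ` e ` span (f ` A) = span (f ` A)" by (force simp: qe)
  qed (use q e qe in auto)
qed

lemma continuous_linear_map_compose:
  assumes "continuous_linear_map U V g" "continuous_linear_map V W h"
  shows "continuous_linear_map U W (h \<circ> g)"
proof -
  have "g x \<in> topspace V" if "x \<in> topspace U" for x
    using that assms(1) by (auto simp: continuous_linear_map_def continuous_map_def)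
  then show ?thesis
    using assms by (auto simp: continuous_linear_map_def intro: continuous_map_compose)
qed

lemma continuous_linear_map_cong:
  assumes "subspace (topspace U)" "\<And>x. x \<in> topspace U \<Longrightarrow> g x = h x" "continuous_linear_map U V g"
  shows "continuous_linear_map U V h"
  using assms continuous_map_eq[of U V g h]
  by (auto simp: continuous_linear_map_def subspace_add subspace_scale)

lemma universal_among_all_types:
  fixes X :: "'a topology" and V :: "'v::real_vector topology"
    and Cu :: "(('a \<Rightarrow>\<^sub>0 real) \<times> 'v) topology \<Rightarrow> bool" and C :: "'y::real_vector topology \<Rightarrow> bool"
  assumes V: "tvs V" "Cv V" and d: "continuous_map X V d"
    and u: "universal_among Cu X V d"
    and pull: "\<And>Y S q. C Y \<Longrightarrow> linear q \<Longrightarrow> subspace S \<Longrightarrow> inj_on q S \<Longrightarrow> Cu (pullback_topology S q Y)"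
    and pullv: "\<And>Y S q. Cv Y \<Longrightarrow> linear q \<Longrightarrow> subspace S \<Longrightarrow> inj_on q S \<Longrightarrow> Cu (pullback_topology S q Y)"
    and CT: "\<And>Y. C Y \<Longrightarrow> tvs Y"
  shows "universal_among C X V d"
proof -
  have subV: "subspace (topspace V)" using V by (simp add: tvs_def)
  have dV: "d ` topspace X \<subseteq> topspace V" using d by (auto simp: continuous_map_def)
  have ext: "\<exists>g. continuous_linear_map V Y g \<and> (\<forall>x\<in>topspace X. g (d x) = f x) \<and>
      g ` topspace V \<subseteq> span (f ` topspace X)"
    if pl: "\<And>S q. linear q \<Longrightarrow> subspace S \<Longrightarrow> inj_on q S \<Longrightarrow> Cu (pullback_topology S q Y)"
      and Y: "tvs Y" and f: "continuous_map X Y f"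
    for Y :: "'z::real_vector topology" and f
  proof -
    obtain q :: "('a \<Rightarrow>\<^sub>0 real) \<times> 'v \<Rightarrow> 'z" and e S where
      q: "linear q" "linear e" "subspace S" "inj_on q S" "q ` S = span (f ` topspace X)"
      "\<And>y. y \<in> span (f ` topspace X) \<Longrightarrow> e y \<in> S \<and> q (e y) = y"
      using embed_span[of f "topspace X"] by blast
    let ?P = "pullback_topology S q Y"
    have fs: "f x \<in> span (f ` topspace X)" if "x \<in> topspace X" for x
      using that by (simp add: span_base)
    have "continuous_map X Y (q \<circ> (e \<circ> f))"
      by (rule continuous_map_eq[OF f]) (use q(6) fs in auto)
    then have "continuous_map X ?P (e \<circ> f)"
      by (rule continuous_map_pullback') (use q(6) fs in auto)
    then obtain g where g: "continuous_linear_map V ?P g" "\<forall>x\<in>topspace X. g (d x) = (e \<circ> f) x"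
      using u pl[OF q(1,3,4)] unfolding universal_among_def by meson
    have "continuous_linear_map ?P Y q"
      using q(1) continuous_map_pullback[OF continuous_map_id, of S q Y]
      by (auto simp: continuous_linear_map_def linear_add linear_scale)
    with g(1) have "continuous_linear_map V Y (q \<circ> g)" by (rule continuous_linear_map_compose)
    moreover have "g ` topspace V \<subseteq> S"
      using g(1) by (auto simp: continuous_linear_map_def continuous_map_def topspace_pullback_topology)
    moreover have "(q \<circ> g) (d x) = f x" if "x \<in> topspace X" for x
      using that g(2) q(6) fs by auto
    ultimately show ?thesis using q(5) by (intro exI[of _ "q \<circ> g"]) auto
  qed
  obtain r where r: "continuous_linear_map V V r" "\<forall>x\<in>topspace X. r (d x) = d x"
    "r ` topspace V \<subseteq> span (d ` topspace X)"
    using ext[of V d] pullv[OF V(2)] V(1) d by blast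
  define j :: "'v \<Rightarrow> ('a \<Rightarrow>\<^sub>0 real) \<times> 'v" where "j v = (0, v)" for v
  let ?J = "pullback_topology (range j) snd V"
  have lj: "linear j" by (auto intro!: linearI simp: j_def)
  have "Cu ?J"
    by (rule pullv[OF V(2) linear_snd])
      (use linear_subspace_image[OF lj subspace_UNIV] in \<open>auto simp: inj_on_def j_def\<close>)
  have jc: "continuous_linear_map V ?J j"
    unfolding continuous_linear_map_def
  proof (intro conjI continuous_map_pullback')
    show "continuous_map V V (snd \<circ> j)" by (simp add: o_def j_def)
  qed (auto simp: j_def)
  have rid: "r v = v" if v: "v \<in> topspace V" for v
  proof -
    have "continuous_map X ?J (j \<circ> d)"
      using jc d by (auto simp: continuous_linear_map_def intro: continuous_map_compose)
    with u \<open>Cu ?J\<close> have uniq: "\<exists>!g. g \<in> extensional (topspace V) \<and> continuous_linear_map V ?J g \<and>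
        (\<forall>x\<in>topspace X. g (d x) = (j \<circ> d) x)"
      unfolding universal_among_def by blast
    have 1: "continuous_linear_map V ?J (restrict j (topspace V))"
      by (rule continuous_linear_map_cong[OF subV _ jc]) auto
    have 2: "continuous_linear_map V ?J (restrict (j \<circ> r) (topspace V))"
      by (rule continuous_linear_map_cong[OF subV _ continuous_linear_map_compose[OF r(1) jc]]) auto
    have "restrict j (topspace V) = restrict (j \<circ> r) (topspace V)"
      by (rule ex1E[OF uniq]) (use 1 2 r(2) dV in \<open>smt (verit, best) comp_apply image_subset_iff restrict_apply' restrict_extensional\<close>)
    then show ?thesis using v by (metis comp_apply j_def restrict_apply' snd_conv)
  qed
  then have Vspan: "topspace V \<subseteq> span (d ` topspace X)" using r(3) by force
  show ?thesis
    unfolding universal_among_def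
  proof (intro allI impI, elim conjE)
    fix Y :: "'y topology" and f assume Y: "C Y" and f: "continuous_map X Y f"
    obtain g where g: "continuous_linear_map V Y g" "\<forall>x\<in>topspace X. g (d x) = f x"
      using ext[OF pull[OF Y] CT[OF Y] f] by blast
    have agree: "h v = h' v"
      if h: "continuous_linear_map V Y h" "\<forall>x\<in>topspace X. h (d x) = f x"
        and h': "continuous_linear_map V Y h'" "\<forall>x\<in>topspace X. h' (d x) = f x"
        and v: "v \<in> topspace V" for h h' v
    proof -
      have "v \<in> span (d ` topspace X)" using v Vspan by auto
      then have "v \<in> topspace V \<and> h v = h' v"
      proof (induction rule: span_induct_alt)
        case base
        have "h (0 *\<^sub>R 0) = 0 *\<^sub>R h 0" "h' (0 *\<^sub>R 0) = 0 *\<^sub>R h' 0"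
          using h(1) h'(1) subspace_0[OF subV] unfolding continuous_linear_map_def by blast+
        then show ?case using subspace_0[OF subV] by simp
      next
        case (step c x y)
        then show ?case
          using h h' dV subV unfolding continuous_linear_map_def
          by (auto simp: subspace_add subspace_scale image_subset_iff)
      qed
      then show ?thesis ..
    qed
    show "\<exists>!g. g \<in> extensional (topspace V) \<and> continuous_linear_map V Y g \<and>
        (\<forall>x\<in>topspace X. g (d x) = f x)"
    proof (rule ex1I[of _ "restrict g (topspace V)"])
      have "continuous_linear_map V Y (restrict g (topspace V))"
        by (rule continuous_linear_map_cong[OF subV _ g(1)]) auto
      then show "restrict g (topspace V) \<in> extensional (topspace V) \<and>
          continuous_linear_map V Y (restrict g (topspace V)) \<and>
          (\<forall>x\<in>topspace X. restrict g (topspace V) (d x) = f x)"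
        using g(2) dV by auto
    next
      fix h assume "h \<in> extensional (topspace V) \<and> continuous_linear_map V Y h \<and>
          (\<forall>x\<in>topspace X. h (d x) = f x)"
      then show "h = restrict g (topspace V)"
        using agree[of h g] g by (intro extensionalityI[of _ "topspace V"]) auto
    qed
  qed
qed

theorem free_tvs_universal:
  assumes "free_tvs X V d"
  shows "universal_among (tvs :: 'y::real_vector topology \<Rightarrow> bool) X V d"
  using assms
  by (auto simp: free_tvs_def intro!: universal_among_all_types[of V tvs X d tvs tvs] tvs_pullback)

theorem free_lcs_universal:
  assumes "free_lcs X V d"
  shows "universal_among (lcs :: 'y::real_vector topology \<Rightarrow> bool) X V d"
  using assms
  by (auto simp: free_lcs_def lcs_def[of V] intro!: universal_among_all_types[of V lcs X d lcs lcs] lcs_pullback)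
    (auto simp: lcs_def)

end

theory Submission
  imports Defs
begin

text \<open>Let \<open>V\<close> be the free space over \<open>X\<close> and \<open>Vn n\<close> the free space over \<open>A n\<close>. The inclusion of
  \<open>A n\<close> into \<open>X\<close> extends to a continuous linear map \<open>g n\<close> from \<open>Vn n\<close> to \<open>V\<close>. The idea is that the
  topology of \<open>V\<close> is recovered from the spaces \<open>Vn n\<close>: choose a neighborhood \<open>N n\<close> of zero in each
  \<open>Vn n\<close> and form the set of all finite sums of elements of the images \<open>g n ` N n\<close>. These sets are a
  base at zero of a linear topology \<open>T\<close> on the algebraic sum of the images, and \<open>T\<close> is locally
  convex if all \<open>Vn n\<close> are.

  On the one hand \<open>T\<close> is finer than the topology of \<open>V\<close>, because any neighborhood of zero in \<open>V\<close>
  contains such a set (\<open>small_sum_of_images\<close>); in particular \<open>T\<close> is Hausdorff. On the other hand the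
  canonical map \<open>d\<close> from \<open>X\<close> to \<open>V\<close> is continuous into \<open>T\<close>: on \<open>A n\<close> it factors through the
  continuous map \<open>g n\<close> into \<open>T\<close>, and continuity on all \<open>A n\<close> suffices for the inductive topology.
  By the universal property \<open>d\<close> extends to a continuous linear map from \<open>V\<close> to \<open>T\<close>, and uniqueness
  of extensions forces this map to be the identity. Hence \<open>T\<close> is coarser than the topology of \<open>V\<close>
  as well, so the sets of sums are a base at zero in \<open>V\<close>.

  If \<open>U n \<alpha>\<close> is a \<open>\<GG>\<close>-base at zero in \<open>Vn n\<close>, then the sums formed from \<open>U n (\<beta> n)\<close> are a base at
  zero in \<open>V\<close> indexed by sequences \<open>\<beta>\<close> of elements of \<open>nat \<Rightarrow> nat\<close>. A pairing bijection turns such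
  sequences into single functions \<open>nat \<Rightarrow> nat\<close>, respecting the pointwise orders
  (\<open>local_G_base_sum\<close>), and translations carry the base to every other point.\<close>

section \<open>Neighborhoods of zero\<close>

definition zero_nbhd :: "'v::real_vector topology \<Rightarrow> 'v set \<Rightarrow> bool" where
  "zero_nbhd T U \<longleftrightarrow> U \<subseteq> topspace T \<and> (\<exists>W. openin T W \<and> 0 \<in> W \<and> W \<subseteq> U)"

lemma zero_nbhd_zero: "zero_nbhd T U \<Longrightarrow> 0 \<in> U"
  by (auto simp: zero_nbhd_def)

lemma zero_nbhd_subset: "zero_nbhd T U \<Longrightarrow> U \<subseteq> topspace T"
  by (simp add: zero_nbhd_def)

lemma zero_nbhd_openin: "openin T U \<Longrightarrow> 0 \<in> U \<Longrightarrow> zero_nbhd T U"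
  using openin_subset by (auto simp: zero_nbhd_def)

lemma zero_nbhd_Int: "zero_nbhd T U \<Longrightarrow> zero_nbhd T U' \<Longrightarrow> zero_nbhd T (U \<inter> U')"
  unfolding zero_nbhd_def by (metis Int_mono inf.coboundedI1 openin_Int IntI)

lemma tvs_zero_in_topspace: "tvs T \<Longrightarrow> 0 \<in> topspace T"
  by (simp add: tvs_def subspace_0)

lemma openin_prod_box:
  assumes "openin (prod_topology X Y) P" "(a, b) \<in> P"
  shows "\<exists>U W. openin X U \<and> openin Y W \<and> a \<in> U \<and> b \<in> W \<and> U \<times> W \<subseteq> P"
  using assms unfolding openin_prod_topology_alt by simp

lemma tvs_add_nbhd:
  assumes T: "tvs T" and U: "zero_nbhd T U"
  shows "\<exists>W. zero_nbhd T W \<and> (\<forall>x\<in>W. \<forall>y\<in>W. x + y \<in> U)"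
proof -
  obtain O1 where O1: "openin T O1" "0 \<in> O1" "O1 \<subseteq> U"
    using U by (auto simp: zero_nbhd_def)
  have op: "openin (prod_topology T T) {z \<in> topspace (prod_topology T T). (case z of (x, y) \<Rightarrow> x + y) \<in> O1}"
    by (rule openin_continuous_map_preimage[OF _ O1(1)]) (use T in \<open>simp add: tvs_def\<close>)
  have "(0, 0) \<in> {z \<in> topspace (prod_topology T T). (case z of (x, y) \<Rightarrow> x + y) \<in> O1}"
    using tvs_zero_in_topspace[OF T] O1 by simp
  from openin_prod_box[OF op this] obtain P Q where PQ: "openin T P" "openin T Q" "0 \<in> P" "0 \<in> Q"
    "P \<times> Q \<subseteq> {z \<in> topspace (prod_topology T T). (case z of (x, y) \<Rightarrow> x + y) \<in> O1}"
    by (elim exE conjE)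
  have "x + y \<in> U" if "x \<in> P \<inter> Q" "y \<in> P \<inter> Q" for x y
  proof -
    have "(x, y) \<in> P \<times> Q" using that by simp
    from subsetD[OF PQ(5) this] show ?thesis using O1(3) by auto
  qed
  moreover have "zero_nbhd T (P \<inter> Q)" using PQ(1-4) by (simp add: zero_nbhd_openin openin_Int)
  ultimately show ?thesis by blast
qed

lemma tvs_continuous_scale:
  assumes T: "tvs T"
  shows "continuous_map T T (\<lambda>x. c *\<^sub>R x)"
proof -
  have "continuous_map T (prod_topology euclideanreal T) (\<lambda>x. (c, x))"
    by (simp add: continuous_map_pairedI)
  then have "continuous_map T T ((\<lambda>(r, x). r *\<^sub>R x) \<circ> (\<lambda>x. (c, x)))"
    using T continuous_map_compose unfolding tvs_def by blast
  then show ?thesis by (simp add: o_def)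
qed

lemma tvs_continuous_translation:
  assumes T: "tvs T" and a: "a \<in> topspace T"
  shows "continuous_map T T (\<lambda>x. x + a)"
proof -
  have "continuous_map T (prod_topology T T) (\<lambda>x. (x, a))"
    using a by (simp add: continuous_map_pairedI)
  then have "continuous_map T T ((\<lambda>(x, y). x + y) \<circ> (\<lambda>x. (x, a)))"
    using T continuous_map_compose unfolding tvs_def by blast
  then show ?thesis by (simp add: o_def)
qed

lemma tvs_openin_translation:
  assumes "tvs T" "a \<in> topspace T" "openin T W"
  shows "openin T {x \<in> topspace T. x + a \<in> W}"
  using openin_continuous_map_preimage[OF tvs_continuous_translation[OF assms(1,2)] assms(3)] .

text \<open>Continuity of scalar multiplication at \<open>(0, 0)\<close> handles only small scalars; multiplication by
  a large constant \<open>k\<close> is continuous and moves the bound on the scalars from \<open>e\<close> up to \<open>c\<close>. This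
  single property replaces the customary balanced neighborhoods: it persists in sums of images
  and suffices for a linear topology.\<close>

lemma tvs_scale_nbhd:
  assumes T: "tvs T" and U: "zero_nbhd T U"
  shows "\<exists>W. zero_nbhd T W \<and> (\<forall>r x. \<bar>r\<bar> \<le> c \<longrightarrow> x \<in> W \<longrightarrow> r *\<^sub>R x \<in> U)"
proof -
  obtain O1 where O1: "openin T O1" "0 \<in> O1" "O1 \<subseteq> U"
    using U by (auto simp: zero_nbhd_def)
  let ?P = "{z \<in> topspace (prod_topology euclideanreal T). (case z of (r, x) \<Rightarrow> r *\<^sub>R x) \<in> O1}"
  have op: "openin (prod_topology euclideanreal T) ?P"
    by (rule openin_continuous_map_preimage[OF _ O1(1)]) (use T in \<open>simp add: tvs_def\<close>)
  have "(0, 0) \<in> ?P"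
    using tvs_zero_in_topspace[OF T] O1 by simp
  from openin_prod_box[OF op this] obtain R Q where RQ: "openin euclideanreal R" "openin T Q" "0 \<in> R" "0 \<in> Q" "R \<times> Q \<subseteq> ?P"
    by (elim exE conjE)
  obtain e where e: "e > 0" "ball 0 e \<subseteq> R"
    using RQ(1,3) by (auto simp: open_contains_ball)
  define k where "k = (\<bar>c\<bar> + 1) / e"
  have k: "k > 0" using e by (simp add: k_def)
  define W where "W = {x \<in> topspace T. k *\<^sub>R x \<in> Q}"
  have "zero_nbhd T W"
    unfolding W_def
    by (rule zero_nbhd_openin[OF openin_continuous_map_preimage[OF tvs_continuous_scale[OF T] RQ(2)]])
      (use RQ(4) tvs_zero_in_topspace[OF T] in auto)
  moreover have "r *\<^sub>R x \<in> U" if r: "\<bar>r\<bar> \<le> c" and x: "x \<in> W" for r x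
  proof -
    have "\<bar>r / k\<bar> = e * (\<bar>r\<bar> / (\<bar>c\<bar> + 1))" using e by (simp add: k_def abs_mult)
    also have "\<dots> < e * 1" using r e by (intro mult_strict_left_mono) auto
    finally have "\<bar>r / k\<bar> < e" by simp
    then have "(r / k, k *\<^sub>R x) \<in> R \<times> Q" using e(2) x by (auto simp: W_def)
    from subsetD[OF RQ(5) this] have "(r / k) *\<^sub>R (k *\<^sub>R x) \<in> O1" by simp
    then show ?thesis using O1(3) k by auto
  qed
  ultimately show ?thesis by blast
qed

lemma tvs_absorbing_nbhd:
  assumes T: "tvs T" and U: "zero_nbhd T U" and x: "x \<in> topspace T"
  shows "\<exists>e>0. \<forall>r. \<bar>r\<bar> < e \<longrightarrow> r *\<^sub>R x \<in> U"
proof -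
  obtain O1 where O1: "openin T O1" "0 \<in> O1" "O1 \<subseteq> U"
    using U by (auto simp: zero_nbhd_def)
  have "continuous_map euclideanreal (prod_topology euclideanreal T) (\<lambda>r. (r, x))"
    using x by (simp add: continuous_map_pairedI)
  then have "continuous_map euclideanreal T ((\<lambda>(r, x). r *\<^sub>R x) \<circ> (\<lambda>r. (r, x)))"
    using T continuous_map_compose unfolding tvs_def by blast
  then have "openin euclideanreal {r \<in> topspace euclideanreal. ((\<lambda>(r, x). r *\<^sub>R x) \<circ> (\<lambda>r. (r, x))) r \<in> O1}"
    using O1(1) openin_continuous_map_preimage by blast
  then have "open {r. r *\<^sub>R x \<in> O1}" by (simp add: o_def)
  moreover have "0 \<in> {r. r *\<^sub>R x \<in> O1}" using O1(2) by simp
  ultimately obtain e where "e > 0" "ball 0 e \<subseteq> {r. r *\<^sub>R x \<in> O1}"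
    using open_contains_ball by metis
  then show ?thesis using O1(3) by (intro exI[of _ e]) auto
qed

section \<open>Linear topologies from a base at zero\<close>

text \<open>The open sets are those that contain with each point a translate of a member of \<open>B\<close>. The
  members of \<open>B\<close> themselves need not be open, which permits bases such as that of all sums of
  arbitrary neighborhoods.\<close>

definition base_topology :: "'v::real_vector set \<Rightarrow> 'v set set \<Rightarrow> 'v topology" where
  "base_topology S B = topology (\<lambda>W. W \<subseteq> S \<and> (\<forall>x\<in>W. \<exists>U\<in>B. \<forall>u\<in>U. x + u \<in> W))"

locale zero_base =
  fixes S :: "'v::real_vector set" and B :: "'v set set"
  assumes S: "subspace S"
    and nonempty: "B \<noteq> {}"
    and mem: "U \<in> B \<Longrightarrow> U \<subseteq> S" "U \<in> B \<Longrightarrow> 0 \<in> U"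
    and directed: "U \<in> B \<Longrightarrow> U' \<in> B \<Longrightarrow> \<exists>W\<in>B. W \<subseteq> U \<inter> U'"
    and add: "U \<in> B \<Longrightarrow> \<exists>W\<in>B. \<forall>x\<in>W. \<forall>y\<in>W. x + y \<in> U"
    and scale: "U \<in> B \<Longrightarrow> \<exists>W\<in>B. \<forall>r x. \<bar>r\<bar> \<le> c \<longrightarrow> x \<in> W \<longrightarrow> r *\<^sub>R x \<in> U"
    and absorbing: "U \<in> B \<Longrightarrow> x \<in> S \<Longrightarrow> \<exists>e>0. \<forall>r. \<bar>r\<bar> < e \<longrightarrow> r *\<^sub>R x \<in> U"
    and separating: "x \<in> S \<Longrightarrow> (\<And>U. U \<in> B \<Longrightarrow> x \<in> U) \<Longrightarrow> x = 0"
begin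

abbreviation T where "T \<equiv> base_topology S B"

lemma openin_T: "openin T W \<longleftrightarrow> W \<subseteq> S \<and> (\<forall>x\<in>W. \<exists>U\<in>B. \<forall>u\<in>U. x + u \<in> W)"
proof -
  have "istopology (\<lambda>W. W \<subseteq> S \<and> (\<forall>x\<in>W. \<exists>U\<in>B. \<forall>u\<in>U. x + u \<in> W))"
    unfolding istopology_def
  proof (intro conjI allI impI)
    fix P Q assume P: "P \<subseteq> S \<and> (\<forall>x\<in>P. \<exists>U\<in>B. \<forall>u\<in>U. x + u \<in> P)"
      and Q: "Q \<subseteq> S \<and> (\<forall>x\<in>Q. \<exists>U\<in>B. \<forall>u\<in>U. x + u \<in> Q)"
    show "P \<inter> Q \<subseteq> S" using P by auto
    show "\<forall>x\<in>P \<inter> Q. \<exists>U\<in>B. \<forall>u\<in>U. x + u \<in> P \<inter> Q"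
    proof
      fix x assume "x \<in> P \<inter> Q"
      then obtain U U' where "U \<in> B" "\<forall>u\<in>U. x + u \<in> P" "U' \<in> B" "\<forall>u\<in>U'. x + u \<in> Q"
        using P Q by blast
      then show "\<exists>U\<in>B. \<forall>u\<in>U. x + u \<in> P \<inter> Q" using directed[of U U'] by blast
    qed
  next
    fix K assume K: "\<forall>W\<in>K. W \<subseteq> S \<and> (\<forall>x\<in>W. \<exists>U\<in>B. \<forall>u\<in>U. x + u \<in> W)"
    then show "\<Union>K \<subseteq> S" by auto
    show "\<forall>x\<in>\<Union>K. \<exists>U\<in>B. \<forall>u\<in>U. x + u \<in> \<Union>K"
      using K by (meson UnionE UnionI)
  qed
  then show ?thesis by (simp add: base_topology_def topology_inverse')
qed

lemma topspace_T: "topspace T = S"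
proof
  show "topspace T \<subseteq> S" using openin_T[of "topspace T"] by simp
  have "openin T S"
    unfolding openin_T using nonempty mem(1) subspace_add[OF S] by blast
  then show "S \<subseteq> topspace T" by (rule openin_subset)
qed

text \<open>The interior of a translate \<open>x + U\<close> does the job: it is open since every \<open>U'\<close> in the base
  contains some \<open>U'' + U''\<close>, so a point with \<open>y + U'\<close> inside \<open>x + U\<close> has a whole translate
  \<open>y + U''\<close> of such points.\<close>

lemma translate_nbhd:
  assumes U: "U \<in> B" and x: "x \<in> S"
  shows "\<exists>W. openin T W \<and> x \<in> W \<and> (\<forall>y\<in>W. y - x \<in> U)"
proof -
  define W where "W = {y \<in> S. \<exists>U'\<in>B. \<forall>u\<in>U'. y + u - x \<in> U}"
  have "openin T W"
    unfolding openin_T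
  proof (intro conjI ballI)
    fix y assume y: "y \<in> W"
    then obtain U' where U': "U' \<in> B" "\<forall>u\<in>U'. y + u - x \<in> U" "y \<in> S" by (auto simp: W_def)
    obtain U'' where U'': "U'' \<in> B" "\<forall>x\<in>U''. \<forall>y\<in>U''. x + y \<in> U'" using add[OF U'(1)] by blast
    have "y + u \<in> W" if u: "u \<in> U''" for u
    proof -
      have "y + u + v - x \<in> U" if "v \<in> U''" for v
        using U'(2) U''(2) u that by (metis add.assoc)
      moreover have "y + u \<in> S" using u U''(1) mem(1) U'(3) S by (blast intro: subspace_add)
      ultimately show ?thesis using U''(1) by (auto simp: W_def)
    qed
    then show "\<exists>U\<in>B. \<forall>u\<in>U. y + u \<in> W" using U''(1) by blast
  qed (auto simp: W_def)
  moreover have "x \<in> W" using x U by (auto simp: W_def)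
  moreover have "y - x \<in> U" if "y \<in> W" for y
    using that mem(2) by (force simp: W_def)
  ultimately show ?thesis by blast
qed

lemma zero_nbhd_T: "zero_nbhd T U \<longleftrightarrow> U \<subseteq> S \<and> (\<exists>U'\<in>B. U' \<subseteq> U)"
proof
  assume "zero_nbhd T U"
  then obtain W where W: "openin T W" "0 \<in> W" "W \<subseteq> U" "U \<subseteq> S"
    by (auto simp: zero_nbhd_def topspace_T)
  then obtain U' where "U' \<in> B" "\<forall>u\<in>U'. 0 + u \<in> W" by (metis openin_T)
  then show "U \<subseteq> S \<and> (\<exists>U'\<in>B. U' \<subseteq> U)" using W by auto
next
  assume U: "U \<subseteq> S \<and> (\<exists>U'\<in>B. U' \<subseteq> U)"
  then obtain U' where "U' \<in> B" "U' \<subseteq> U" by blast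
  then show "zero_nbhd T U"
    using U translate_nbhd[of U' 0] subspace_0[OF S] by (force simp: zero_nbhd_def topspace_T)
qed

lemma tvs_T: "tvs T"
  unfolding tvs_def
proof (intro conjI)
  show "subspace (topspace T)" by (simp add: topspace_T S)
  show "Hausdorff_space T"
    unfolding Hausdorff_space_def topspace_T
  proof (intro allI impI, elim conjE)
    fix x y assume xy: "x \<in> S" "y \<in> S" "x \<noteq> y"
    then obtain U where U: "U \<in> B" "y - x \<notin> U"
      using separating[of "y - x"] subspace_diff[OF S] by (metis eq_iff_diff_eq_0)
    obtain P where P: "P \<in> B" "\<forall>x\<in>P. \<forall>y\<in>P. x + y \<in> U" using add[OF U(1)] by blast
    obtain Q where Q: "Q \<in> B" "\<forall>r x. \<bar>r\<bar> \<le> 1 \<longrightarrow> x \<in> Q \<longrightarrow> r *\<^sub>R x \<in> P" using scale[OF P(1)] by blast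
    obtain V where V: "openin T V" "x \<in> V" "\<forall>z\<in>V. z - x \<in> Q" using translate_nbhd[OF Q(1) xy(1)] by blast
    obtain W where W: "openin T W" "y \<in> W" "\<forall>z\<in>W. z - y \<in> Q" using translate_nbhd[OF Q(1) xy(2)] by blast
    have "z \<notin> W" if "z \<in> V" for z
    proof
      assume "z \<in> W"
      then have "z - x \<in> Q" "z - y \<in> Q" using V(3) W(3) that by auto
      moreover have "\<bar>1 :: real\<bar> \<le> 1" "\<bar>- 1 :: real\<bar> \<le> 1" by auto
      ultimately have "1 *\<^sub>R (z - x) \<in> P" "(-1) *\<^sub>R (z - y) \<in> P" using Q(2) by blast+
      then have "1 *\<^sub>R (z - x) + (-1) *\<^sub>R (z - y) \<in> U" using P(2) by blast
      then show False using U(2) by simp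
    qed
    then show "\<exists>V W. openin T V \<and> openin T W \<and> x \<in> V \<and> y \<in> W \<and> disjnt V W"
      using V W by (meson disjnt_iff)
  qed
  show "continuous_map (prod_topology T T) T (\<lambda>(x, y). x + y)"
    unfolding continuous_map_eq_topcontinuous_at topcontinuous_at_def
  proof (intro ballI conjI allI impI)
    fix z assume z: "z \<in> topspace (prod_topology T T)"
    then show "z \<in> topspace (prod_topology T T)" .
    show "(\<lambda>(x, y). x + y) \<in> topspace (prod_topology T T) \<rightarrow> topspace T"
      by (auto simp: topspace_T subspace_add[OF S])
    fix W assume W: "openin T W \<and> (case z of (x, y) \<Rightarrow> x + y) \<in> W"
    obtain x y where xy: "z = (x, y)" "x \<in> S" "y \<in> S" using z by (auto simp: topspace_T)
    obtain U where U: "U \<in> B" "\<forall>u\<in>U. (x + y) + u \<in> W" using W xy(1) by (auto simp: openin_T)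
    obtain P where P: "P \<in> B" "\<forall>x\<in>P. \<forall>y\<in>P. x + y \<in> U" using add[OF U(1)] by blast
    obtain Q where Q: "openin T Q" "x \<in> Q" "\<forall>z\<in>Q. z - x \<in> P" using translate_nbhd[OF P(1) xy(2)] by blast
    obtain R where R: "openin T R" "y \<in> R" "\<forall>z\<in>R. z - y \<in> P" using translate_nbhd[OF P(1) xy(3)] by blast
    \<comment> \<open>\<open>a + b\<close> differs from \<open>x + y\<close> by \<open>(a - x) + (b - y)\<close>.\<close>
    have "a + b \<in> W" if "a \<in> Q" "b \<in> R" for a b
    proof -
      have "(a - x) + (b - y) \<in> U" using that P(2) Q(3) R(3) by blast
      then have "(x + y) + ((a - x) + (b - y)) \<in> W" using U(2) by blast
      then show ?thesis by (simp add: algebra_simps)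
    qed
    then show "\<exists>Q. openin (prod_topology T T) Q \<and> z \<in> Q \<and> (\<forall>y\<in>Q. (case y of (x, y) \<Rightarrow> x + y) \<in> W)"
      using Q R xy(1) by (intro exI[of _ "Q \<times> R"]) (auto simp: openin_prod_Times_iff)
  qed
  show "continuous_map (prod_topology euclideanreal T) T (\<lambda>(r, x). r *\<^sub>R x)"
    unfolding continuous_map_eq_topcontinuous_at topcontinuous_at_def
  proof (intro ballI conjI allI impI)
    fix z assume z: "z \<in> topspace (prod_topology euclideanreal T)"
    then show "z \<in> topspace (prod_topology euclideanreal T)" .
    show "(\<lambda>(r, x). r *\<^sub>R x) \<in> topspace (prod_topology euclideanreal T) \<rightarrow> topspace T"
      by (auto simp: topspace_T subspace_scale[OF S])
    fix W assume W: "openin T W \<and> (case z of (r, x) \<Rightarrow> r *\<^sub>R x) \<in> W"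
    obtain s x where sx: "z = (s, x)" "x \<in> S" using z by (auto simp: topspace_T)
    obtain U where U: "U \<in> B" "\<forall>u\<in>U. s *\<^sub>R x + u \<in> W" using W sx(1) by (auto simp: openin_T)
    obtain P where P: "P \<in> B" "\<forall>x\<in>P. \<forall>y\<in>P. x + y \<in> U" using add[OF U(1)] by blast
    obtain N where N: "N \<in> B" "\<forall>r x. \<bar>r\<bar> \<le> \<bar>s\<bar> + 1 \<longrightarrow> x \<in> N \<longrightarrow> r *\<^sub>R x \<in> P" using scale[OF P(1)] by blast
    obtain e where e: "e > 0" "\<forall>r. \<bar>r\<bar> < e \<longrightarrow> r *\<^sub>R x \<in> P" using absorbing[OF P(1) sx(2)] by blast
    obtain Q where Q: "openin T Q" "x \<in> Q" "\<forall>z\<in>Q. z - x \<in> N" using translate_nbhd[OF N(1) sx(2)] by blast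
    \<comment> \<open>\<open>r a\<close> differs from \<open>s x\<close> by \<open>r (a - x) + (r - s) x\<close>. The radius is at most 1 to keep \<open>r\<close> bounded
      in the first term, and at most \<open>e\<close> to make the second small because \<open>P\<close> absorbs \<open>x\<close>.\<close>
    have "r *\<^sub>R a \<in> W" if r: "r \<in> ball s (min e 1)" and a: "a \<in> Q" for r a
    proof -
      have "\<bar>r - s\<bar> < e" "\<bar>r\<bar> \<le> \<bar>s\<bar> + 1" using r by (auto simp: dist_real_def)
      then have "r *\<^sub>R (a - x) + (r - s) *\<^sub>R x \<in> U" using a P(2) N(2) Q(3) e(2) by blast
      then have "s *\<^sub>R x + (r *\<^sub>R (a - x) + (r - s) *\<^sub>R x) \<in> W" using U(2) by blast
      then show ?thesis by (simp add: algebra_simps)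
    qed
    then show "\<exists>Q. openin (prod_topology euclideanreal T) Q \<and> z \<in> Q \<and> (\<forall>y\<in>Q. (case y of (r, x) \<Rightarrow> r *\<^sub>R x) \<in> W)"
      using Q e sx(1) by (intro exI[of _ "ball s (min e 1) \<times> Q"]) (auto simp: openin_prod_Times_iff)
  qed
qed

text \<open>A convex set between two members of the base is itself a neighborhood of zero. In sums of images,
  \<open>C\<close> is the sum of convex neighborhoods.\<close>

lemma lcs_T:
  assumes cvx: "\<And>U. U \<in> B \<Longrightarrow> \<exists>W\<in>B. \<exists>C. convex C \<and> W \<subseteq> C \<and> C \<subseteq> U"
  shows "lcs T"
  unfolding lcs_def neighbourhood_base_at_def
proof (intro conjI allI impI tvs_T)
  fix O1 assume "openin T O1 \<and> 0 \<in> O1"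
  then obtain U where U: "U \<in> B" "U \<subseteq> O1"
    using zero_nbhd_T[of O1] zero_nbhd_openin[of T O1] by blast
  obtain W C where C: "W \<in> B" "convex C" "W \<subseteq> C" "C \<subseteq> U" using cvx[OF U(1)] by blast
  then have "zero_nbhd T C" using zero_nbhd_T mem(1)[OF U(1)] by blast
  then show "\<exists>Oc V. openin T Oc \<and> convex V \<and> 0 \<in> Oc \<and> Oc \<subseteq> V \<and> V \<subseteq> O1"
    using C U(2) unfolding zero_nbhd_def by (meson order_trans)
qed

end

section \<open>Sums of countably many continuous linear images\<close>

definition sum_of_images :: "(nat \<Rightarrow> 'v \<Rightarrow> 'w::real_vector) \<Rightarrow> (nat \<Rightarrow> 'v set) \<Rightarrow> 'w set" where
  "sum_of_images g N = {\<Sum>i<m. g i (u i) | m u. \<forall>i<m. u i \<in> N i}"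

lemma sum_of_images_mono:
  "(\<And>n. N n \<subseteq> N' n) \<Longrightarrow> sum_of_images g N \<subseteq> sum_of_images g N'"
  unfolding sum_of_images_def by blast

locale linear_images =
  fixes Vn :: "nat \<Rightarrow> 'v::real_vector topology" and V :: "'w::real_vector topology"
    and g :: "nat \<Rightarrow> 'v \<Rightarrow> 'w"
  assumes Vn: "tvs (Vn n)" and V: "tvs V" and g: "continuous_linear_map (Vn n) V (g n)"
begin

abbreviation S where "S \<equiv> sum_of_images g (\<lambda>n. topspace (Vn n))"
definition B where "B = {sum_of_images g N | N. \<forall>n. zero_nbhd (Vn n) (N n)}"

lemma g_zero: "g n 0 = 0"
proof -
  have "g n (0 *\<^sub>R 0) = 0 *\<^sub>R g n 0"
    using g[of n] tvs_zero_in_topspace[OF Vn] unfolding continuous_linear_map_def by blast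
  then show ?thesis by simp
qed

lemma g_add: "x \<in> topspace (Vn n) \<Longrightarrow> y \<in> topspace (Vn n) \<Longrightarrow> g n (x + y) = g n x + g n y"
  using g[of n] by (simp add: continuous_linear_map_def)

lemma g_scale: "x \<in> topspace (Vn n) \<Longrightarrow> g n (r *\<^sub>R x) = r *\<^sub>R g n x"
  using g[of n] by (simp add: continuous_linear_map_def)

lemma g_cont: "continuous_map (Vn n) V (g n)"
  using g[of n] by (simp add: continuous_linear_map_def)

text \<open>Padding with zeros: once all \<open>N n\<close> contain zero, the number of summands can be increased at
  will, so that two elements may be written with equally many.\<close>

lemma sum_of_images_E:
  assumes x: "x \<in> sum_of_images g N" and 0: "\<And>n. 0 \<in> N n"
  obtains M where "\<And>m. m \<ge> M \<Longrightarrow> \<exists>u. (\<forall>i. u i \<in> N i) \<and> x = (\<Sum>i<m. g i (u i))"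
proof -
  obtain M u where u: "x = (\<Sum>i<M. g i (u i))" "\<forall>i<M. u i \<in> N i"
    using x by (auto simp: sum_of_images_def)
  show thesis
  proof
    fix m assume m: "m \<ge> M"
    define u' where "u' i = (if i < M then u i else 0)" for i
    have "x = (\<Sum>i<M. g i (u' i))" using u by (simp add: u'_def)
    also have "\<dots> = (\<Sum>i<m. g i (u' i))"
      using m by (intro sum.mono_neutral_left) (auto simp: u'_def g_zero)
    finally show "\<exists>u. (\<forall>i. u i \<in> N i) \<and> x = (\<Sum>i<m. g i (u i))"
      using u 0 by (intro exI[of _ u']) (auto simp: u'_def)
  qed
qed

lemma sum_of_images_combine:
  assumes x: "x \<in> sum_of_images g N" and y: "y \<in> sum_of_images g N'"
    and 0: "\<And>n. 0 \<in> N n" "\<And>n. 0 \<in> N' n"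
  obtains m u v where "\<And>i. u i \<in> N i" "\<And>i. v i \<in> N' i"
    "x = (\<Sum>i<m. g i (u i))" "y = (\<Sum>i<m. g i (v i))"
proof -
  obtain M where M: "\<And>m. m \<ge> M \<Longrightarrow> \<exists>u. (\<forall>i. u i \<in> N i) \<and> x = (\<Sum>i<m. g i (u i))"
    using sum_of_images_E[OF x 0(1)] by blast
  obtain M' where M': "\<And>m. m \<ge> M' \<Longrightarrow> \<exists>u. (\<forall>i. u i \<in> N' i) \<and> y = (\<Sum>i<m. g i (u i))"
    using sum_of_images_E[OF y 0(2)] by blast
  show thesis using M[of "max M M'"] M'[of "max M M'"] that by auto
qed

text \<open>Linear combinations are formed summand by summand. Sums, scalar multiples and convex
  combinations in the base at zero are all instances of this.\<close>

lemma sum_of_images_lincomb: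
  assumes x: "x \<in> sum_of_images g N" and y: "y \<in> sum_of_images g N'"
    and 0: "\<And>n. 0 \<in> N n" "\<And>n. 0 \<in> N' n"
    and sub: "\<And>n. N n \<subseteq> topspace (Vn n)" "\<And>n. N' n \<subseteq> topspace (Vn n)"
    and K: "\<And>n a b. a \<in> N n \<Longrightarrow> b \<in> N' n \<Longrightarrow> r *\<^sub>R a + s *\<^sub>R b \<in> K n"
  shows "r *\<^sub>R x + s *\<^sub>R y \<in> sum_of_images g K"
proof -
  obtain m u v where uv: "\<And>i. u i \<in> N i" "\<And>i. v i \<in> N' i"
    "x = (\<Sum>i<m. g i (u i))" "y = (\<Sum>i<m. g i (v i))"
    using sum_of_images_combine[OF x y 0] by blast
  have uvT: "u i \<in> topspace (Vn i)" "v i \<in> topspace (Vn i)" for i using uv sub by blast+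
  have "g i (r *\<^sub>R u i + s *\<^sub>R v i) = r *\<^sub>R g i (u i) + s *\<^sub>R g i (v i)" for i
    using uvT Vn[of i] by (simp add: g_add g_scale tvs_def subspace_scale)
  then have "r *\<^sub>R x + s *\<^sub>R y = (\<Sum>i<m. g i (r *\<^sub>R u i + s *\<^sub>R v i))"
    by (simp add: uv(3,4) scaleR_sum_right sum.distrib)
  moreover have "r *\<^sub>R u i + s *\<^sub>R v i \<in> K i" for i by (rule K[OF uv(1,2)])
  ultimately show ?thesis
    unfolding sum_of_images_def by (intro CollectI exI[of _ m] exI[of _ "\<lambda>i. r *\<^sub>R u i + s *\<^sub>R v i"]) auto
qed

lemma sum_of_images_scale:
  assumes x: "x \<in> sum_of_images g N"
    and 0: "\<And>n. 0 \<in> N n" and sub: "\<And>n. N n \<subseteq> topspace (Vn n)"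
    and K: "\<And>n a. a \<in> N n \<Longrightarrow> r *\<^sub>R a \<in> K n"
  shows "r *\<^sub>R x \<in> sum_of_images g K"
  using sum_of_images_lincomb[OF x x 0 0 sub sub, of r 0 K] K by simp

lemma image_subset_sum_of_images:
  assumes 0: "\<And>n. 0 \<in> N n" and x: "x \<in> N n"
  shows "g n x \<in> sum_of_images g N"
proof -
  have "g n x = (\<Sum>i<Suc n. g i (if i = n then x else 0))"
    by (simp add: g_zero)
  then show ?thesis using assms unfolding sum_of_images_def by fastforce
qed

text \<open>Choose neighborhoods \<open>P n\<close> of zero in \<open>V\<close> with \<open>P (n + 1) + P (n + 1)\<close> inside \<open>P n\<close> and \<open>P 0\<close>
  inside \<open>U\<close>. If the summand with index \<open>n\<close> is taken from \<open>P (n + 1)\<close>, then by summing from the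
  last index downwards every tail starting at \<open>k\<close> stays in \<open>P k\<close>. So preimages of \<open>P (n + 1)\<close>
  serve as \<open>N n\<close>.\<close>

lemma small_sum_of_images:
  assumes U: "zero_nbhd V U"
  shows "\<exists>N. (\<forall>n. zero_nbhd (Vn n) (N n)) \<and> sum_of_images g N \<subseteq> U"
proof -
  obtain O1 where O1: "openin V O1" "0 \<in> O1" "O1 \<subseteq> U"
    using U by (auto simp: zero_nbhd_def)
  have "\<exists>f. \<forall>n. (openin V (f n) \<and> 0 \<in> f n \<and> (n = 0 \<longrightarrow> f n = O1)) \<and>
      (\<forall>x\<in>f (Suc n). \<forall>y\<in>f (Suc n). x + y \<in> f n)"
  proof (rule dependent_nat_choice)
    show "\<exists>x. openin V x \<and> 0 \<in> x \<and> (0 = (0::nat) \<longrightarrow> x = O1)" using O1 by auto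
  next
    fix P n assume P: "openin V P \<and> 0 \<in> P \<and> (n = (0::nat) \<longrightarrow> P = O1)"
    obtain W where W: "zero_nbhd V W" "\<forall>x\<in>W. \<forall>y\<in>W. x + y \<in> P"
      using tvs_add_nbhd[OF V zero_nbhd_openin[of V P]] P by blast
    then obtain Q where "openin V Q" "0 \<in> Q" "Q \<subseteq> W" by (auto simp: zero_nbhd_def)
    then show "\<exists>Q. (openin V Q \<and> 0 \<in> Q \<and> (Suc n = 0 \<longrightarrow> Q = O1)) \<and> (\<forall>x\<in>Q. \<forall>y\<in>Q. x + y \<in> P)"
      using W(2) by blast
  qed
  then obtain P where P: "\<And>n. openin V (P n)" "\<And>n. 0 \<in> P n" "P 0 = O1"
    "\<And>n x y. x \<in> P (Suc n) \<Longrightarrow> y \<in> P (Suc n) \<Longrightarrow> x + y \<in> P n" by blast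
  define N where "N n = {x \<in> topspace (Vn n). g n x \<in> P (Suc n)}" for n
  have N: "zero_nbhd (Vn n) (N n)" for n
    unfolding N_def
    by (rule zero_nbhd_openin[OF openin_continuous_map_preimage[OF g_cont P(1)]])
      (simp add: tvs_zero_in_topspace[OF Vn] g_zero P(2))
  have tail: "(\<Sum>i<m. x (k + i)) \<in> P k" if "\<And>i. i < m \<Longrightarrow> x (k + i) \<in> P (Suc (k + i))" for m k and x :: "nat \<Rightarrow> 'w"
    using that
  proof (induction m arbitrary: k)
    case 0
    then show ?case by (simp add: P(2))
  next
    case (Suc m)
    have "(\<Sum>i<m. x (Suc k + i)) \<in> P (Suc k)"
      by (rule Suc.IH) (use Suc.prems[of "Suc _"] in simp)
    then have "x k + (\<Sum>i<m. x (Suc k + i)) \<in> P k" using Suc.prems[of 0] P(4) by simp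
    then show ?case by (simp add: sum.lessThan_Suc_shift del: sum.lessThan_Suc)
  qed
  have "sum_of_images g N \<subseteq> U"
  proof
    fix z assume "z \<in> sum_of_images g N"
    then obtain m u where "z = (\<Sum>i<m. g i (u i))" "\<forall>i<m. u i \<in> N i"
      by (auto simp: sum_of_images_def)
    then show "z \<in> U" using tail[of m "\<lambda>i. g i (u i)" 0] P(3) O1(3) by (auto simp: N_def)
  qed
  with N show ?thesis by blast
qed

lemma S_subset: "S \<subseteq> topspace V"
proof
  fix z assume "z \<in> S"
  then obtain m u where z: "z = (\<Sum>i<m. g i (u i))" "\<forall>i<m. u i \<in> topspace (Vn i)"
    by (auto simp: sum_of_images_def)
  have "g i (u i) \<in> topspace V" if "i < m" for i
    using continuous_map_image_subset_topspace[OF g_cont[of i]] z(2) that by blast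
  moreover have "subspace (topspace V)" using V by (simp add: tvs_def)
  ultimately show "z \<in> topspace V"
    unfolding z(1) using subspace_sum[of "topspace V" "{..<m}" "\<lambda>i. g i (u i)"] by blast
qed

text \<open>Each requirement is inherited from the spaces \<open>Vn n\<close>, except separation of points, which comes
  from \<open>V\<close> being Hausdorff. Only finitely many summands of a given \<open>x\<close> are nonzero; this is why the
  sums absorb points even though infinitely many neighborhoods \<open>N n\<close> are involved.\<close>

sublocale zero_base S B
proof
  have Vn0: "0 \<in> topspace (Vn n)" for n by (rule tvs_zero_in_topspace[OF Vn])
  have Vs: "subspace (topspace (Vn n))" for n using Vn by (simp add: tvs_def)
  show "subspace S"
    unfolding subspace_def
  proof (intro conjI ballI allI)
    show "0 \<in> S" using image_subset_sum_of_images[of "\<lambda>n. topspace (Vn n)" 0 0] Vn0 by (simp add: g_zero)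
    show "x + y \<in> S" if "x \<in> S" "y \<in> S" for x y
      using sum_of_images_lincomb[OF that Vn0 Vn0, of 1 1 "\<lambda>n. topspace (Vn n)"] Vs
      by (simp add: subspace_add)
    show "c *\<^sub>R x \<in> S" if "x \<in> S" for c x
      by (rule sum_of_images_scale[OF that Vn0]) (simp_all add: Vs subspace_scale)
  qed
  have "zero_nbhd (Vn n) (topspace (Vn n))" for n by (simp add: Vn0 zero_nbhd_openin)
  then have "S \<in> B" unfolding B_def by blast
  then show "B \<noteq> {}" by blast
  fix U assume "U \<in> B"
  then obtain N where N: "U = sum_of_images g N" "\<And>n. zero_nbhd (Vn n) (N n)" by (auto simp: B_def)
  note N0 = zero_nbhd_zero[OF N(2)] and Ns = zero_nbhd_subset[OF N(2)]
  show "U \<subseteq> S" unfolding N(1) by (rule sum_of_images_mono[OF Ns])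
  show "0 \<in> U" using image_subset_sum_of_images[of N 0 0] N0 by (simp add: g_zero N(1))
  show "\<exists>W\<in>B. W \<subseteq> U \<inter> U'" if U': "U' \<in> B" for U'
  proof -
    obtain N' where N': "U' = sum_of_images g N'" "\<And>n. zero_nbhd (Vn n) (N' n)"
      using U' by (auto simp: B_def)
    have "sum_of_images g (\<lambda>n. N n \<inter> N' n) \<in> B" using zero_nbhd_Int[OF N(2) N'(2)] by (auto simp: B_def)
    then show ?thesis
      using sum_of_images_mono[of "\<lambda>n. N n \<inter> N' n" N g] sum_of_images_mono[of "\<lambda>n. N n \<inter> N' n" N' g]
      unfolding N(1) N'(1) by (intro bexI[of _ "sum_of_images g (\<lambda>n. N n \<inter> N' n)"]) auto
  qed
  show "\<exists>W\<in>B. \<forall>x\<in>W. \<forall>y\<in>W. x + y \<in> U"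
  proof -
    obtain K where K: "\<And>n. zero_nbhd (Vn n) (K n)" "\<And>n x y. x \<in> K n \<Longrightarrow> y \<in> K n \<Longrightarrow> x + y \<in> N n"
      using tvs_add_nbhd[OF Vn N(2)] by metis
    note K0 = zero_nbhd_zero[OF K(1)] and Ks = zero_nbhd_subset[OF K(1)]
    have "x + y \<in> U" if "x \<in> sum_of_images g K" "y \<in> sum_of_images g K" for x y
      using sum_of_images_lincomb[OF that K0 K0 Ks Ks, of 1 1 N] K(2) N(1) by simp
    then show ?thesis using K(1) unfolding B_def by blast
  qed
  show "\<exists>W\<in>B. \<forall>r x. \<bar>r\<bar> \<le> c \<longrightarrow> x \<in> W \<longrightarrow> r *\<^sub>R x \<in> U" for c
  proof -
    obtain K where K: "\<And>n. zero_nbhd (Vn n) (K n)" "\<And>n r x. \<bar>r\<bar> \<le> c \<Longrightarrow> x \<in> K n \<Longrightarrow> r *\<^sub>R x \<in> N n"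
      using tvs_scale_nbhd[OF Vn N(2), where c = c] by metis
    note K0 = zero_nbhd_zero[OF K(1)] and Ks = zero_nbhd_subset[OF K(1)]
    have "r *\<^sub>R x \<in> U" if "\<bar>r\<bar> \<le> c" "x \<in> sum_of_images g K" for r x
      unfolding N(1) by (rule sum_of_images_scale[OF that(2) K0 Ks]) (rule K(2)[OF that(1)])
    then show ?thesis using K(1) unfolding B_def by blast
  qed
  show "\<exists>e>0. \<forall>r. \<bar>r\<bar> < e \<longrightarrow> r *\<^sub>R x \<in> U" if xS: "x \<in> S" for x
  proof -
    obtain m u where u: "x = (\<Sum>i<m. g i (u i))" "\<forall>i<m. u i \<in> topspace (Vn i)"
      using xS by (auto simp: sum_of_images_def)
    have "\<exists>e>0. i < m \<longrightarrow> (\<forall>r. \<bar>r\<bar> < e \<longrightarrow> r *\<^sub>R u i \<in> N i)" for i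
    proof (cases "i < m")
      case True
      then show ?thesis using tvs_absorbing_nbhd[OF Vn N(2), of "u i" i] u(2) by blast
    qed (auto intro: exI[of _ 1])
    then obtain e where e: "\<And>i. e i > (0::real)" "\<And>i. i < m \<longrightarrow> (\<forall>r. \<bar>r\<bar> < e i \<longrightarrow> r *\<^sub>R u i \<in> N i)"
      by metis
    define d where "d = Min (insert 1 (e ` {..<m}))"
    have "d > 0" using e(1) by (simp add: d_def)
    moreover have "r *\<^sub>R x \<in> U" if r: "\<bar>r\<bar> < d" for r
    proof -
      have "r *\<^sub>R x = (\<Sum>i<m. g i (r *\<^sub>R u i))"
        using u by (simp add: scaleR_sum_right g_scale)
      moreover have "r *\<^sub>R u i \<in> N i" if "i < m" for i
        using e(2)[of i] r that by (auto simp: d_def)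
      ultimately show ?thesis
        unfolding N(1) sum_of_images_def by (intro CollectI exI[of _ m] exI[of _ "\<lambda>i. r *\<^sub>R u i"]) auto
    qed
    ultimately show ?thesis by blast
  qed
next
  fix x assume x: "x \<in> S" "\<And>U. U \<in> B \<Longrightarrow> x \<in> U"
  show "x = 0"
  proof (rule ccontr)
    assume "x \<noteq> 0"
    moreover have "Hausdorff_space V" using V by (simp add: tvs_def)
    ultimately obtain P Q where "openin V P" "openin V Q" "0 \<in> P" "x \<in> Q" "disjnt P Q"
      using tvs_zero_in_topspace[OF V] x(1) S_subset unfolding Hausdorff_space_def by (metis subsetD)
    then obtain N where "\<forall>n. zero_nbhd (Vn n) (N n)" "sum_of_images g N \<subseteq> P"
      using small_sum_of_images[OF zero_nbhd_openin] by blast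
    then have "x \<in> P" using x(2) unfolding B_def by blast
    then show False using \<open>x \<in> Q\<close> \<open>disjnt P Q\<close> by (auto simp: disjnt_iff)
  qed
qed

lemma continuous_inclusion: "continuous_map T V id"
  unfolding continuous_map_eq_topcontinuous_at topcontinuous_at_def
proof (intro ballI conjI allI impI)
  fix x assume x: "x \<in> topspace T"
  then show "x \<in> topspace T" .
  show "id \<in> topspace T \<rightarrow> topspace V" using S_subset by (auto simp: topspace_T)
  fix W assume W: "openin V W \<and> id x \<in> W"
  have xV: "x \<in> topspace V" using x S_subset by (auto simp: topspace_T)
  have "zero_nbhd V {y \<in> topspace V. y + x \<in> W}"
    by (rule zero_nbhd_openin[OF tvs_openin_translation[OF V xV]])
      (use W tvs_zero_in_topspace[OF V] in auto)
  then obtain N where N: "\<forall>n. zero_nbhd (Vn n) (N n)" "sum_of_images g N \<subseteq> {y \<in> topspace V. y + x \<in> W}"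
    using small_sum_of_images by blast
  then have "sum_of_images g N \<in> B" by (auto simp: B_def)
  then obtain Q where Q: "openin T Q" "x \<in> Q" "\<forall>y\<in>Q. y - x \<in> sum_of_images g N"
    using translate_nbhd x by (metis topspace_T)
  have "\<forall>y\<in>Q. y \<in> W" using Q(3) N(2) by force
  then show "\<exists>U. openin T U \<and> x \<in> U \<and> (\<forall>y\<in>U. id y \<in> W)" using Q by auto
qed

lemma continuous_summand: "continuous_map (Vn n) T (g n)"
  unfolding continuous_map_eq_topcontinuous_at topcontinuous_at_def
proof (intro ballI conjI allI impI)
  fix x assume x: "x \<in> topspace (Vn n)"
  then show "x \<in> topspace (Vn n)" .
  show "g n \<in> topspace (Vn n) \<rightarrow> topspace T"
    using image_subset_sum_of_images[of "\<lambda>n. topspace (Vn n)"] tvs_zero_in_topspace[OF Vn]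
    by (auto simp: topspace_T)
  fix W assume W: "openin T W \<and> g n x \<in> W"
  then obtain U where U: "U \<in> B" "\<forall>u\<in>U. g n x + u \<in> W" by (auto simp: openin_T)
  then obtain N where N: "U = sum_of_images g N" "\<And>n. zero_nbhd (Vn n) (N n)" by (auto simp: B_def)
  obtain P where P: "openin (Vn n) P" "0 \<in> P" "P \<subseteq> N n" using N(2)[of n] by (auto simp: zero_nbhd_def)
  have sV: "subspace (topspace (Vn n))" using Vn by (simp add: tvs_def)
  have mx: "- x \<in> topspace (Vn n)" using x sV by (simp add: subspace_neg)
  let ?Q = "{y \<in> topspace (Vn n). y + - x \<in> P}"
  have "openin (Vn n) ?Q" by (rule tvs_openin_translation[OF Vn mx P(1)])
  moreover have "x \<in> ?Q" using x P(2) by simp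
  moreover have "g n y \<in> W" if y: "y \<in> ?Q" for y
  proof -
    have "g n (y + - x) \<in> U" unfolding N(1)
      by (rule image_subset_sum_of_images[OF zero_nbhd_zero[OF N(2)]]) (use y P(3) in auto)
    then have "g n x + g n (y + - x) \<in> W" using U(2) by blast
    moreover have "g n (x + (y + - x)) = g n x + g n (y + - x)"
      by (rule g_add) (use x y openin_subset[OF P(1)] in auto)
    ultimately show ?thesis by simp
  qed
  ultimately show "\<exists>U. openin (Vn n) U \<and> x \<in> U \<and> (\<forall>y\<in>U. g n y \<in> W)" by blast
qed

lemma convex_sum_of_images:
  assumes "\<And>n. zero_nbhd (Vn n) (N n)" "\<And>n. convex (N n)"
  shows "convex (sum_of_images g N)"
  unfolding convex_def
proof (intro ballI allI impI)
  fix x y u v assume *: "x \<in> sum_of_images g N" "y \<in> sum_of_images g N" "0 \<le> (u::real)" "0 \<le> v" "u + v = 1"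
  note N0 = zero_nbhd_zero[OF assms(1)] and Ns = zero_nbhd_subset[OF assms(1)]
  show "u *\<^sub>R x + v *\<^sub>R y \<in> sum_of_images g N"
    by (rule sum_of_images_lincomb[OF *(1,2) N0 N0 Ns Ns]) (use * assms(2) in \<open>auto simp: convex_def\<close>)
qed

lemma lcs_sum:
  assumes "\<And>n. lcs (Vn n)"
  shows "lcs T"
proof (rule lcs_T)
  fix U assume "U \<in> B"
  then obtain N where N: "U = sum_of_images g N" "\<And>n. zero_nbhd (Vn n) (N n)" by (auto simp: B_def)
  have "\<exists>C. zero_nbhd (Vn n) C \<and> convex C \<and> C \<subseteq> N n" for n
  proof -
    obtain W where W: "openin (Vn n) W" "0 \<in> W" "W \<subseteq> N n" using N(2)[of n] by (auto simp: zero_nbhd_def)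
    then obtain O1 C where "openin (Vn n) O1" "convex C" "0 \<in> O1" "O1 \<subseteq> C" "C \<subseteq> W"
      using assms[of n] unfolding lcs_def neighbourhood_base_at_def by meson
    then show ?thesis using W openin_subset[OF W(1)] unfolding zero_nbhd_def by (meson order_trans)
  qed
  then obtain C where C: "\<And>n. zero_nbhd (Vn n) (C n)" "\<And>n. convex (C n)" "\<And>n. C n \<subseteq> N n" by metis
  have "sum_of_images g C \<in> B" using C(1) by (auto simp: B_def)
  moreover have "sum_of_images g C \<subseteq> U" unfolding N(1) by (rule sum_of_images_mono[OF C(3)])
  ultimately show "\<exists>W\<in>B. \<exists>C. convex C \<and> W \<subseteq> C \<and> C \<subseteq> U"
    using convex_sum_of_images[OF C(1,2)] by blast
qed

text \<open>The premise \<open>fine\<close> says that the topology of \<open>V\<close> is as fine as \<open>T\<close>; it is the part that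
  depends on the universal property.\<close>

lemma local_G_base_sum:
  assumes fine: "\<And>N. (\<And>n. zero_nbhd (Vn n) (N n)) \<Longrightarrow> zero_nbhd V (sum_of_images g N)"
    and G: "\<And>n. local_G_base (Vn n)"
  shows "local_G_base V"
proof -
  have "\<forall>n. \<exists>U :: (nat \<Rightarrow> nat) \<Rightarrow> 'v set.
     (\<forall>\<alpha>. zero_nbhd (Vn n) (U \<alpha>)) \<and>
     (\<forall>W. openin (Vn n) W \<and> 0 \<in> W \<longrightarrow> (\<exists>\<alpha>. U \<alpha> \<subseteq> W)) \<and>
     (\<forall>\<alpha> \<beta>. \<alpha> \<le> \<beta> \<longrightarrow> U \<beta> \<subseteq> U \<alpha>)"
    using G tvs_zero_in_topspace[OF Vn] unfolding local_G_base_def zero_nbhd_def by simp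
  then obtain U :: "nat \<Rightarrow> (nat \<Rightarrow> nat) \<Rightarrow> 'v set" where U: "\<And>n \<alpha>. zero_nbhd (Vn n) (U n \<alpha>)"
    "\<And>n W. openin (Vn n) W \<Longrightarrow> 0 \<in> W \<Longrightarrow> \<exists>\<alpha>. U n \<alpha> \<subseteq> W"
    "\<And>n \<alpha> \<beta>. \<alpha> \<le> \<beta> \<Longrightarrow> U n \<beta> \<subseteq> U n \<alpha>"
    by metis
  \<comment> \<open>The \<open>n\<close>-th row of \<open>\<alpha>\<close>, read as a matrix through the pairing bijection, selects the neighborhood in
    \<open>Vn n\<close>.\<close>
  define D where "D \<alpha> = sum_of_images g (\<lambda>n. U n (\<lambda>k. \<alpha> (prod_encode (n, k))))" for \<alpha>
  have D: "zero_nbhd V (D \<alpha>)" for \<alpha> unfolding D_def by (rule fine) (rule U(1))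
  have Dmono: "D \<beta> \<subseteq> D \<alpha>" if "\<alpha> \<le> \<beta>" for \<alpha> \<beta>
    unfolding D_def by (intro sum_of_images_mono U(3)) (use that in \<open>simp add: le_fun_def\<close>)
  have Dsmall: "\<exists>\<alpha>. D \<alpha> \<subseteq> P" if P: "zero_nbhd V P" for P
  proof -
    obtain N where N: "\<forall>n. zero_nbhd (Vn n) (N n)" "sum_of_images g N \<subseteq> P"
      using small_sum_of_images[OF P] by blast
    have "\<exists>\<alpha>. U n \<alpha> \<subseteq> N n" for n
      using N(1) U(2) unfolding zero_nbhd_def by (meson order_trans)
    then obtain \<beta> where \<beta>: "\<And>n. U n (\<beta> n) \<subseteq> N n" by metis
    define \<alpha> where "\<alpha> j = (case prod_decode j of (n, k) \<Rightarrow> \<beta> n k)" for j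
    have "D \<alpha> \<subseteq> sum_of_images g N" unfolding D_def \<alpha>_def by (rule sum_of_images_mono) (simp add: \<beta>)
    then show ?thesis using N(2) by blast
  qed
  have sV: "subspace (topspace V)" using V by (simp add: tvs_def)
  show ?thesis
    unfolding local_G_base_def
  proof
    fix x assume x: "x \<in> topspace V"
    have 1: "(+) x ` D \<alpha> \<subseteq> topspace V" for \<alpha>
      using zero_nbhd_subset[OF D] x sV by (auto intro: subspace_add)
    have 2: "\<exists>W. openin V W \<and> x \<in> W \<and> W \<subseteq> (+) x ` D \<alpha>" for \<alpha>
    proof -
      obtain P where P: "openin V P" "0 \<in> P" "P \<subseteq> D \<alpha>" using D[of \<alpha>] by (auto simp: zero_nbhd_def)
      have mx: "- x \<in> topspace V" using x sV by (simp add: subspace_neg)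
      have "y \<in> (+) x ` D \<alpha>" if "y + - x \<in> P" for y
        by (rule image_eqI[of _ _ "y + - x"]) (use that P(3) in auto)
      then show ?thesis
        using tvs_openin_translation[OF V mx P(1)] x P(2)
        by (intro exI[of _ "{y \<in> topspace V. y + - x \<in> P}"]) auto
    qed
    have 3: "\<exists>\<alpha>. (+) x ` D \<alpha> \<subseteq> W" if W: "openin V W" "x \<in> W" for W
    proof -
      have "zero_nbhd V {y \<in> topspace V. y + x \<in> W}"
        by (rule zero_nbhd_openin[OF tvs_openin_translation[OF V x W(1)]])
          (use W tvs_zero_in_topspace[OF V] in auto)
      then obtain \<alpha> where \<alpha>: "D \<alpha> \<subseteq> {y \<in> topspace V. y + x \<in> W}" using Dsmall by blast
      have "x + y \<in> W" if "y \<in> D \<alpha>" for y using \<alpha> that by (metis (no_types, lifting) CollectD add.commute subsetD)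
      then show ?thesis by blast
    qed
    show "\<exists>U :: (nat \<Rightarrow> nat) \<Rightarrow> 'w set.
        (\<forall>\<alpha>. U \<alpha> \<subseteq> topspace V \<and> (\<exists>W. openin V W \<and> x \<in> W \<and> W \<subseteq> U \<alpha>)) \<and>
        (\<forall>W. openin V W \<and> x \<in> W \<longrightarrow> (\<exists>\<alpha>. U \<alpha> \<subseteq> W)) \<and> (\<forall>\<alpha> \<beta>. \<alpha> \<le> \<beta> \<longrightarrow> U \<beta> \<subseteq> U \<alpha>)"
      by (rule exI[of _ "\<lambda>\<alpha>. (+) x ` D \<alpha>"]) (use 1 2 3 Dmono in \<open>simp add: image_mono\<close>)
  qed
qed

end

section \<open>Free spaces over inductive topologies\<close>

lemma continuous_map_inductive:
  assumes ind: "has_inductive_topology X A"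
    and into: "\<And>x. x \<in> topspace X \<Longrightarrow> f x \<in> topspace Y"
    and f: "\<And>n. continuous_map (subtopology X (A n)) Y f"
  shows "continuous_map X Y f"
  unfolding continuous_map_def
proof (intro conjI allI impI)
  fix W assume W: "openin Y W"
  have "openin (subtopology X (A n)) ({x \<in> topspace X. f x \<in> W} \<inter> A n)" for n
  proof -
    have "{x \<in> topspace X. f x \<in> W} \<inter> A n = {x \<in> topspace (subtopology X (A n)). f x \<in> W}" by auto
    then show ?thesis using openin_continuous_map_preimage[OF f W] by simp
  qed
  then show "openin X {x \<in> topspace X. f x \<in> W}"
    using ind unfolding has_inductive_topology_def by auto
qed (use into in auto)

lemma universal_endomorphism_identity:
  fixes V :: "'w::real_vector topology"
  assumes u: "universal_among C X V d" and CV: "C V" and V: "tvs V" and d: "continuous_map X V d"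
    and h: "continuous_linear_map V V h" "\<And>x. x \<in> topspace X \<Longrightarrow> h (d x) = d x"
    and v: "v \<in> topspace V"
  shows "h v = v"
proof -
  have sub: "subspace (topspace V)" using V by (simp add: tvs_def)
  have dV: "d x \<in> topspace V" if "x \<in> topspace X" for x using d that by (auto simp: continuous_map_def)
  have uniq: "\<exists>!g. g \<in> extensional (topspace V) \<and> continuous_linear_map V V g \<and>
      (\<forall>x\<in>topspace X. g (d x) = d x)"
    using u CV d unfolding universal_among_def by blast
  have 1: "continuous_linear_map V V (restrict h (topspace V))"
    by (rule continuous_linear_map_cong[OF sub _ h(1)]) simp
  have "continuous_linear_map V V id" by (simp add: continuous_linear_map_def)
  then have 2: "continuous_linear_map V V (restrict id (topspace V))"
    by (rule continuous_linear_map_cong[OF sub, rotated]) simp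
  have "restrict h (topspace V) = restrict id (topspace V)"
    using uniq unfolding Ex1_def
  proof (elim exE conjE)
    fix k assume k: "\<forall>y. y \<in> extensional (topspace V) \<and> continuous_linear_map V V y \<and>
      (\<forall>x\<in>topspace X. y (d x) = d x) \<longrightarrow> y = k"
    have "restrict h (topspace V) = k" by (rule mp[OF spec[OF k]]) (use 1 h(2) dV in simp)
    moreover have "restrict id (topspace V) = k" by (rule mp[OF spec[OF k]]) (use 2 dV in simp)
    ultimately show "restrict h (topspace V) = restrict id (topspace V)" by simp
  qed
  then show ?thesis using v by (metis id_apply restrict_apply')
qed

text \<open>The class \<open>C\<close> stands for all topological vector spaces or for the locally convex ones. What
  matters is that the topology generated by the sums of images stays in \<open>C\<close>, so that the universal
  property of \<open>V\<close> applies to it as a target. That every element of \<open>V\<close> is a sum of elements of the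
  images is a consequence, since the extension of \<open>d\<close> has its values among these sums and is the
  identity.\<close>

lemma local_G_base_of_universal:
  fixes X :: "'a topology" and A :: "nat \<Rightarrow> 'a set"
    and Vn :: "nat \<Rightarrow> 'v::real_vector topology" and dn :: "nat \<Rightarrow> 'a \<Rightarrow> 'v"
    and V :: "'w::real_vector topology" and d :: "'a \<Rightarrow> 'w" and C :: "'w topology \<Rightarrow> bool"
  assumes cover: "(\<Union>n. A n) = topspace X" and ind: "has_inductive_topology X A"
    and summands: "\<And>n. tvs (Vn n)" "\<And>n. continuous_map (subtopology X (A n)) (Vn n) (dn n)"
      "\<And>n. universal_among C (subtopology X (A n)) (Vn n) (dn n)"
    and total: "tvs V" "C V" "continuous_map X V d" "universal_among C X V d"
    and closed: "\<And>g. linear_images Vn V g \<Longrightarrow> C (base_topology (sum_of_images g (\<lambda>n. topspace (Vn n))) (linear_images.B Vn g))"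
    and G: "\<And>n. local_G_base (Vn n)"
  shows "local_G_base V"
proof -
  have "\<exists>g. continuous_linear_map (Vn n) V g \<and> (\<forall>x\<in>topspace (subtopology X (A n)). g (dn n x) = d x)" for n
    using summands(3)[of n] total(2) continuous_map_from_subtopology[OF total(3), of "A n"]
    unfolding universal_among_def by blast
  then obtain g where ext: "\<And>n. continuous_linear_map (Vn n) V (g n)"
    "\<And>n x. x \<in> topspace (subtopology X (A n)) \<Longrightarrow> g n (dn n x) = d x" by metis
  interpret linear_images Vn V g by unfold_locales (use summands(1) total(1) ext(1) in auto)
  have dn: "continuous_map (subtopology X (A n)) T d" for n
    by (rule continuous_map_eq[OF continuous_map_compose[OF summands(2) continuous_summand]])
      (simp add: ext(2)[unfolded topspace_subtopology])
  have d: "continuous_map X T d"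
  proof (rule continuous_map_inductive[OF ind _ dn])
    fix x assume "x \<in> topspace X"
    then obtain n where "x \<in> topspace (subtopology X (A n))" using cover by auto
    then show "d x \<in> topspace T" using dn by (auto simp: continuous_map_def)
  qed
  have "C T" by (rule closed) unfold_locales
  then obtain h where h: "continuous_linear_map V T h" "\<forall>x\<in>topspace X. h (d x) = d x"
    using total(4) d unfolding universal_among_def by blast
  have "continuous_linear_map T V id" using continuous_inclusion by (simp add: continuous_linear_map_def)
  then have "continuous_linear_map V V (id \<circ> h)" by (rule continuous_linear_map_compose[OF h(1)])
  then have hid: "h v = v" if "v \<in> topspace V" for v
    using universal_endomorphism_identity[OF total(4,2,1,3) _ _ that, of "id \<circ> h"] h(2) by simp
  show ?thesis
  proof (rule local_G_base_sum[OF _ G])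
    fix N assume N: "\<And>n. zero_nbhd (Vn n) (N n)"
    then have "sum_of_images g N \<in> B" by (auto simp: B_def)
    then have "zero_nbhd T (sum_of_images g N)" using zero_nbhd_T mem(1) by blast
    then obtain W where W: "openin T W" "0 \<in> W" "W \<subseteq> sum_of_images g N" "sum_of_images g N \<subseteq> S"
      by (auto simp: zero_nbhd_def topspace_T)
    have "continuous_map V T h" using h(1) by (simp add: continuous_linear_map_def)
    then have "openin V {v \<in> topspace V. h v \<in> W}" using W(1) openin_continuous_map_preimage by blast
    moreover have "{v \<in> topspace V. h v \<in> W} = W" using W(3,4) S_subset by (auto simp: hid subset_iff)
    ultimately show "zero_nbhd V (sum_of_images g N)"
      using W S_subset by (auto simp: zero_nbhd_def)
  qed
qed

theorem theorem9p4:
  fixes X :: "'a topology" and A :: "nat \<Rightarrow> 'a set"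
    and Vn :: "nat \<Rightarrow> 'v::real_vector topology" and dVn :: "nat \<Rightarrow> 'a \<Rightarrow> 'v"
    and V :: "'w::real_vector topology" and dV :: "'a \<Rightarrow> 'w"
    and Ln :: "nat \<Rightarrow> 'l::real_vector topology" and dLn :: "nat \<Rightarrow> 'a \<Rightarrow> 'l"
    and L :: "'m::real_vector topology" and dL :: "'a \<Rightarrow> 'm"
  assumes tychonoff: "completely_regular_space X" "Hausdorff_space X"
    and cover: "(\<Union>n. A n) = topspace X"
    and inductive_top: "has_inductive_topology X A"
  shows "((\<forall>n. free_tvs (subtopology X (A n)) (Vn n) (dVn n)) \<and> free_tvs X V dV \<longrightarrow>
            (\<forall>n. local_G_base (Vn n)) \<longrightarrow> local_G_base V) \<and>
         ((\<forall>n. free_lcs (subtopology X (A n)) (Ln n) (dLn n)) \<and> free_lcs X L dL \<longrightarrow>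
            (\<forall>n. local_G_base (Ln n)) \<longrightarrow> local_G_base L)"
proof (intro conjI impI; elim conjE)
  assume Vn: "\<forall>n. free_tvs (subtopology X (A n)) (Vn n) (dVn n)" and V: "free_tvs X V dV"
    and G: "\<forall>n. local_G_base (Vn n)"
  show "local_G_base V"
  proof (rule local_G_base_of_universal[OF cover inductive_top, where C = tvs and Vn = Vn and dn = dVn and d = dV])
    show "tvs (base_topology (sum_of_images g (\<lambda>n. topspace (Vn n))) (linear_images.B Vn g))"
      if "linear_images Vn V g" for g
    proof -
      interpret linear_images Vn V g by fact
      show ?thesis by (rule tvs_T)
    qed
  qed (use Vn V G in \<open>auto simp: free_tvs_def intro: free_tvs_universal[unfolded free_tvs_def]\<close>)
next
  assume Ln: "\<forall>n. free_lcs (subtopology X (A n)) (Ln n) (dLn n)" and L: "free_lcs X L dL"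
    and G: "\<forall>n. local_G_base (Ln n)"
  have lcs: "lcs (Ln n)" for n using Ln by (simp add: free_lcs_def)
  show "local_G_base L"
  proof (rule local_G_base_of_universal[OF cover inductive_top, where C = lcs and Vn = Ln and dn = dLn and d = dL])
    show "lcs (base_topology (sum_of_images g (\<lambda>n. topspace (Ln n))) (linear_images.B Ln g))"
      if "linear_images Ln L g" for g
    proof -
      interpret linear_images Ln L g by fact
      show ?thesis by (rule lcs_sum[OF lcs])
    qed
    show "tvs (Ln n)" for n using lcs by (simp add: lcs_def)
    show "tvs L" using L by (simp add: free_lcs_def lcs_def)
  qed (use Ln L G in \<open>auto simp: free_lcs_def intro: free_lcs_universal[unfolded free_lcs_def]\<close>)
qed

end
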